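(* Suppose that $F$ admits a terminal coalgebra $(Z,\gamma)$. Let $R$ be a relational connector of $F$. (1) $R$-similarity is sound iff $R1_Z=1_{FZ}$. (2) If $F$ preserves monomorphisms, then $R$-similarity is sound iff $R1_A=1_{FA}$ for every set $A$ of cardinality at most $|Z|$.
   Context: $F\colon\mathbf{Set}\to\mathbf{Set}$ is a functor. Relations $r\subseteq X\times Y$ are composed applicatively, $r^\circ$ is the converse, functions are regarded as relations, $1_X$ is the identity relation. An $F$-relator $R$ is a monotone assignment of $Rr\subseteq FX\times FY$ to each $r\subseteq X\times Y$; it is a relational connector if $1_{FX}\le R1_X$ for every set $X$ and $R(g^\circ\cdot r\cdot f)=(Fg)^\circ\cdot Rr\cdot Ff$ for all relations $r\subseteq X\times Y$ and functions $f\colon A\to X$, $g\colon B\to Y$. Given coalgebras $\alpha\colon X\to FX$, $\beta\colon Y\to FY$, $r$ is an $R$-simulation if $r\le\beta^\circ\cdot Rr\cdot\alpha$; $R$-similarity (greatest $R$-simulation) is sound if it is always contained in behavioural equivalence. *)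

theory Defs
  imports "HOL-Library.FuncSet" "HOL-Library.Equipollence"
begin

text \<open>
  HOL cannot quantify over functors on the category of all sets.  The category Set is therefore
  rendered as the category of the sets in \<open>U\<close>, where \<open>U\<close> is an arbitrary collection of subsets
  of an arbitrary type with the three closure properties below.  Every Grothendieck universe with
  a nonempty element is of this form, and so are, for example, the collection of all subsets of
  an infinite type and the collection of all its subsets of cardinality less than a given infinite
  cardinal.  Every collection of this form contains arbitrarily large finite sets.
\<close>

definition set_universe :: "'a set set \<Rightarrow> bool" where
  "set_universe U \<longleftrightarrow>
     (\<exists>x. {x} \<in> U) \<and>
     (\<forall>A\<in>U. \<forall>B. B \<lesssim> A \<longrightarrow> B \<in> U) \<and>
     (\<forall>A\<in>U. \<forall>B\<in>U. \<exists>C\<in>U. C \<approx> A <+> B)"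

text \<open>
  The morphisms from \<open>X\<close> to \<open>Y\<close> are the elements of \<open>X \<rightarrow>\<^sub>E Y\<close>, which are undefined outside \<open>X\<close>,
  so that equality of morphisms is equality in HOL.  A functor consists of an object part \<open>F\<close> and
  a morphism part \<open>Fm\<close>, the latter also taking the domain and the codomain.
\<close>

definition set_functor ::
  "'a set set \<Rightarrow> ('a set \<Rightarrow> 'a set) \<Rightarrow> ('a set \<Rightarrow> 'a set \<Rightarrow> ('a \<Rightarrow> 'a) \<Rightarrow> 'a \<Rightarrow> 'a) \<Rightarrow> bool" where
  "set_functor U F Fm \<longleftrightarrow>
     (\<forall>X\<in>U. F X \<in> U) \<and>
     (\<forall>X\<in>U. \<forall>Y\<in>U. \<forall>f \<in> X \<rightarrow>\<^sub>E Y. Fm X Y f \<in> F X \<rightarrow>\<^sub>E F Y) \<and>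
     (\<forall>X\<in>U. Fm X X (\<lambda>x\<in>X. x) = (\<lambda>a\<in>F X. a)) \<and>
     (\<forall>X\<in>U. \<forall>Y\<in>U. \<forall>W\<in>U. \<forall>f \<in> X \<rightarrow>\<^sub>E Y. \<forall>g \<in> Y \<rightarrow>\<^sub>E W.
        Fm X W (compose X g f) = compose (F X) (Fm Y W g) (Fm X Y f))"

definition monomorphism :: "'a set set \<Rightarrow> 'a set \<Rightarrow> 'a set \<Rightarrow> ('a \<Rightarrow> 'a) \<Rightarrow> bool" where
  "monomorphism U X Y f \<longleftrightarrow>
     f \<in> X \<rightarrow>\<^sub>E Y \<and>
     (\<forall>W\<in>U. \<forall>g \<in> W \<rightarrow>\<^sub>E X. \<forall>h \<in> W \<rightarrow>\<^sub>E X. compose W f g = compose W f h \<longrightarrow> g = h)"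

definition preserves_monomorphisms ::
  "'a set set \<Rightarrow> ('a set \<Rightarrow> 'a set) \<Rightarrow> ('a set \<Rightarrow> 'a set \<Rightarrow> ('a \<Rightarrow> 'a) \<Rightarrow> 'a \<Rightarrow> 'a) \<Rightarrow> bool" where
  "preserves_monomorphisms U F Fm \<longleftrightarrow>
     (\<forall>X\<in>U. \<forall>Y\<in>U. \<forall>f. monomorphism U X Y f \<longrightarrow> monomorphism U (F X) (F Y) (Fm X Y f))"

definition coalgebra :: "'a set set \<Rightarrow> ('a set \<Rightarrow> 'a set) \<Rightarrow> 'a set \<Rightarrow> ('a \<Rightarrow> 'a) \<Rightarrow> bool" where
  "coalgebra U F X \<alpha> \<longleftrightarrow> X \<in> U \<and> \<alpha> \<in> X \<rightarrow>\<^sub>E F X"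

definition coalgebra_hom ::
  "('a set \<Rightarrow> 'a set \<Rightarrow> ('a \<Rightarrow> 'a) \<Rightarrow> 'a \<Rightarrow> 'a) \<Rightarrow>
   'a set \<Rightarrow> ('a \<Rightarrow> 'a) \<Rightarrow> 'a set \<Rightarrow> ('a \<Rightarrow> 'a) \<Rightarrow> ('a \<Rightarrow> 'a) \<Rightarrow> bool" where
  "coalgebra_hom Fm X \<alpha> Y \<beta> f \<longleftrightarrow>
     f \<in> X \<rightarrow>\<^sub>E Y \<and> compose X (Fm X Y f) \<alpha> = compose X \<beta> f"

definition terminal_coalgebra ::
  "'a set set \<Rightarrow> ('a set \<Rightarrow> 'a set) \<Rightarrow> ('a set \<Rightarrow> 'a set \<Rightarrow> ('a \<Rightarrow> 'a) \<Rightarrow> 'a \<Rightarrow> 'a) \<Rightarrow>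
   'a set \<Rightarrow> ('a \<Rightarrow> 'a) \<Rightarrow> bool" where
  "terminal_coalgebra U F Fm Z \<gamma> \<longleftrightarrow>
     coalgebra U F Z \<gamma> \<and>
     (\<forall>X \<alpha>. coalgebra U F X \<alpha> \<longrightarrow> (\<exists>!f. coalgebra_hom Fm X \<alpha> Z \<gamma> f))"

definition behavioural_equivalence ::
  "'a set set \<Rightarrow> ('a set \<Rightarrow> 'a set) \<Rightarrow> ('a set \<Rightarrow> 'a set \<Rightarrow> ('a \<Rightarrow> 'a) \<Rightarrow> 'a \<Rightarrow> 'a) \<Rightarrow>
   'a set \<Rightarrow> ('a \<Rightarrow> 'a) \<Rightarrow> 'a set \<Rightarrow> ('a \<Rightarrow> 'a) \<Rightarrow> ('a \<times> 'a) set" where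
  "behavioural_equivalence U F Fm X \<alpha> Y \<beta> =
     {(x, y). x \<in> X \<and> y \<in> Y \<and>
        (\<exists>W \<delta> f g. coalgebra U F W \<delta> \<and> coalgebra_hom Fm X \<alpha> W \<delta> f \<and>
           coalgebra_hom Fm Y \<beta> W \<delta> g \<and> f x = g y)}"

text \<open>
  The relation operator \<open>O\<close> composes diagrammatically, so the applicative composite \<open>s \<cdot> r\<close> is
  \<open>r O s\<close>.
\<close>

definition graph_of :: "'a set \<Rightarrow> ('a \<Rightarrow> 'a) \<Rightarrow> ('a \<times> 'a) set" where
  "graph_of X f = {(x, f x) | x. x \<in> X}"

definition relator ::
  "'a set set \<Rightarrow> ('a set \<Rightarrow> 'a set) \<Rightarrow>
   ('a set \<Rightarrow> 'a set \<Rightarrow> ('a \<times> 'a) set \<Rightarrow> ('a \<times> 'a) set) \<Rightarrow> bool" where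
  "relator U F R \<longleftrightarrow>
     (\<forall>X\<in>U. \<forall>Y\<in>U. \<forall>r. r \<subseteq> X \<times> Y \<longrightarrow> R X Y r \<subseteq> F X \<times> F Y) \<and>
     (\<forall>X\<in>U. \<forall>Y\<in>U. \<forall>r s. r \<subseteq> s \<longrightarrow> s \<subseteq> X \<times> Y \<longrightarrow> R X Y r \<subseteq> R X Y s)"

definition relational_connector ::
  "'a set set \<Rightarrow> ('a set \<Rightarrow> 'a set) \<Rightarrow> ('a set \<Rightarrow> 'a set \<Rightarrow> ('a \<Rightarrow> 'a) \<Rightarrow> 'a \<Rightarrow> 'a) \<Rightarrow>
   ('a set \<Rightarrow> 'a set \<Rightarrow> ('a \<times> 'a) set \<Rightarrow> ('a \<times> 'a) set) \<Rightarrow> bool" where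
  "relational_connector U F Fm R \<longleftrightarrow>
     relator U F R \<and>
     (\<forall>X\<in>U. Id_on (F X) \<subseteq> R X X (Id_on X)) \<and>
     (\<forall>X\<in>U. \<forall>Y\<in>U. \<forall>A\<in>U. \<forall>B\<in>U. \<forall>r. \<forall>f \<in> A \<rightarrow>\<^sub>E X. \<forall>g \<in> B \<rightarrow>\<^sub>E Y. r \<subseteq> X \<times> Y \<longrightarrow>
        R A B (graph_of A f O r O (graph_of B g)\<inverse>) =
          graph_of (F A) (Fm A X f) O R X Y r O (graph_of (F B) (Fm B Y g))\<inverse>)"

definition simulation ::
  "('a set \<Rightarrow> 'a set \<Rightarrow> ('a \<times> 'a) set \<Rightarrow> ('a \<times> 'a) set) \<Rightarrow>
   'a set \<Rightarrow> ('a \<Rightarrow> 'a) \<Rightarrow> 'a set \<Rightarrow> ('a \<Rightarrow> 'a) \<Rightarrow> ('a \<times> 'a) set \<Rightarrow> bool" where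
  "simulation R X \<alpha> Y \<beta> r \<longleftrightarrow>
     r \<subseteq> X \<times> Y \<and> r \<subseteq> graph_of X \<alpha> O R X Y r O (graph_of Y \<beta>)\<inverse>"

definition similarity ::
  "('a set \<Rightarrow> 'a set \<Rightarrow> ('a \<times> 'a) set \<Rightarrow> ('a \<times> 'a) set) \<Rightarrow>
   'a set \<Rightarrow> ('a \<Rightarrow> 'a) \<Rightarrow> 'a set \<Rightarrow> ('a \<Rightarrow> 'a) \<Rightarrow> ('a \<times> 'a) set" where
  "similarity R X \<alpha> Y \<beta> = \<Union> {r. simulation R X \<alpha> Y \<beta> r}"

text \<open>By monotonicity, the union of all simulations is the greatest simulation.\<close>

lemma simulation_similarity:
  assumes "relator U F R" "X \<in> U" "Y \<in> U"
  shows "simulation R X \<alpha> Y \<beta> (similarity R X \<alpha> Y \<beta>)"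
proof -
  let ?s = "similarity R X \<alpha> Y \<beta>"
  have sub: "?s \<subseteq> X \<times> Y"
    unfolding similarity_def simulation_def by blast
  have "r \<subseteq> graph_of X \<alpha> O R X Y ?s O (graph_of Y \<beta>)\<inverse>" if r: "simulation R X \<alpha> Y \<beta> r" for r
  proof -
    have "r \<subseteq> ?s"
      using r unfolding similarity_def by blast
    then have "R X Y r \<subseteq> R X Y ?s"
      using assms sub unfolding relator_def by blast
    then show ?thesis
      using r unfolding simulation_def by blast
  qed
  then have "?s \<subseteq> graph_of X \<alpha> O R X Y ?s O (graph_of Y \<beta>)\<inverse>"
    unfolding similarity_def by blast
  with sub show ?thesis
    unfolding simulation_def by blast
qed

definition similarity_sound ::
  "'a set set \<Rightarrow> ('a set \<Rightarrow> 'a set) \<Rightarrow> ('a set \<Rightarrow> 'a set \<Rightarrow> ('a \<Rightarrow> 'a) \<Rightarrow> 'a \<Rightarrow> 'a) \<Rightarrow>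
   ('a set \<Rightarrow> 'a set \<Rightarrow> ('a \<times> 'a) set \<Rightarrow> ('a \<times> 'a) set) \<Rightarrow> bool" where
  "similarity_sound U F Fm R \<longleftrightarrow>
     (\<forall>X \<alpha> Y \<beta>. coalgebra U F X \<alpha> \<longrightarrow> coalgebra U F Y \<beta> \<longrightarrow>
        similarity R X \<alpha> Y \<beta> \<subseteq> behavioural_equivalence U F Fm X \<alpha> Y \<beta>)"

end

theory Submission
  imports Defs
begin

text \<open>
  The image of a simulation under the morphisms into the terminal coalgebra is a simulation on
  \<open>(Z, \<gamma>)\<close>.  Let \<open>s\<close> be a simulation on \<open>(Z, \<gamma>)\<close> and let \<open>q\<close> choose a representative of each class
  of the equivalence generated by \<open>s\<close>.  If \<open>R 1\<^sub>Z = 1\<close>, then \<open>R s \<le> (F q)\<^sup>\<circ> \<cdot> F q\<close>, so \<open>F q \<cdot> \<gamma>\<close> is constant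
  on the classes and \<open>q\<close> is a morphism from \<open>\<gamma>\<close> to \<open>F q \<cdot> \<gamma>\<close>; by terminality \<open>q\<close> has a left inverse,
  hence \<open>s \<le> 1\<^sub>Z\<close>.  Conversely, by Lambek's lemma a pair in \<open>R 1\<^sub>Z\<close> has the form \<open>(\<gamma> u, \<gamma> v)\<close>, which makes
  \<open>1\<^sub>Z \<union> {(u, v)}\<close> a simulation, so that soundness gives \<open>u = v\<close>.  For the second part, an injection
  \<open>m : A \<rightarrow> Z\<close> gives \<open>R 1\<^sub>A = (F m)\<^sup>\<circ> \<cdot> R 1\<^sub>Z \<cdot> F m\<close>.
\<close>

section \<open>Functors and coalgebra morphisms\<close>

lemma functor_map:
  assumes "set_functor U F Fm" "X \<in> U" "Y \<in> U" "f \<in> X \<rightarrow>\<^sub>E Y"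
  shows "Fm X Y f \<in> F X \<rightarrow>\<^sub>E F Y"
  using assms unfolding set_functor_def by blast

lemma functor_compose:
  assumes "set_functor U F Fm" "X \<in> U" "Y \<in> U" "W \<in> U" "f \<in> X \<rightarrow>\<^sub>E Y" "g \<in> Y \<rightarrow>\<^sub>E W"
  shows "Fm X W (compose X g f) = compose (F X) (Fm Y W g) (Fm X Y f)"
  using assms unfolding set_functor_def by blast

lemma functor_compose_apply:
  assumes "set_functor U F Fm" "X \<in> U" "Y \<in> U" "W \<in> U" "f \<in> X \<rightarrow>\<^sub>E Y" "g \<in> Y \<rightarrow>\<^sub>E W" "a \<in> F X"
  shows "Fm X W (compose X g f) a = Fm Y W g (Fm X Y f a)"
  using functor_compose[OF assms(1-6)] assms(7) by (simp add: compose_eq)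

lemma functor_id:
  assumes "set_functor U F Fm" "X \<in> U"
  shows "Fm X X (\<lambda>x\<in>X. x) = (\<lambda>a\<in>F X. a)"
  using assms unfolding set_functor_def by blast

lemma compose_PiE: "f \<in> X \<rightarrow>\<^sub>E Y \<Longrightarrow> g \<in> Y \<rightarrow>\<^sub>E W \<Longrightarrow> compose X g f \<in> X \<rightarrow>\<^sub>E W"
  by (auto simp: compose_def)

lemma coalgebra_hom_apply:
  assumes "coalgebra_hom Fm X \<alpha> Y \<beta> f" "x \<in> X"
  shows "Fm X Y f (\<alpha> x) = \<beta> (f x)"
  using assms unfolding coalgebra_hom_def by (metis compose_eq)

lemma coalgebra_homI:
  assumes "f \<in> X \<rightarrow>\<^sub>E Y" "\<And>x. x \<in> X \<Longrightarrow> Fm X Y f (\<alpha> x) = \<beta> (f x)"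
  shows "coalgebra_hom Fm X \<alpha> Y \<beta> f"
  using assms unfolding coalgebra_hom_def by (auto simp: compose_def)

lemma coalgebra_hom_id:
  assumes "set_functor U F Fm" "coalgebra U F X \<alpha>"
  shows "coalgebra_hom Fm X \<alpha> X \<alpha> (\<lambda>x\<in>X. x)"
proof (rule coalgebra_homI)
  show "(\<lambda>x\<in>X. x) \<in> X \<rightarrow>\<^sub>E X"
    by simp
  have "X \<in> U" "\<And>x. x \<in> X \<Longrightarrow> \<alpha> x \<in> F X"
    using assms(2) by (auto simp: coalgebra_def)
  then show "Fm X X (\<lambda>x\<in>X. x) (\<alpha> x) = \<alpha> ((\<lambda>x\<in>X. x) x)" if "x \<in> X" for x
    using that by (simp add: functor_id[OF assms(1)])
qed

lemma coalgebra_hom_compose: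
  assumes F: "set_functor U F Fm"
    and co: "coalgebra U F X \<alpha>" "coalgebra U F Y \<beta>" "coalgebra U F W \<delta>"
    and f: "coalgebra_hom Fm X \<alpha> Y \<beta> f" and g: "coalgebra_hom Fm Y \<beta> W \<delta> g"
  shows "coalgebra_hom Fm X \<alpha> W \<delta> (compose X g f)"
proof (rule coalgebra_homI)
  have fg: "f \<in> X \<rightarrow>\<^sub>E Y" "g \<in> Y \<rightarrow>\<^sub>E W"
    using f g by (auto simp: coalgebra_hom_def)
  then show "compose X g f \<in> X \<rightarrow>\<^sub>E W"
    by (rule compose_PiE)
  show "Fm X W (compose X g f) (\<alpha> x) = \<delta> (compose X g f x)" if x: "x \<in> X" for x
  proof -
    have "\<alpha> x \<in> F X" "X \<in> U" "Y \<in> U" "W \<in> U"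
      using co x by (auto simp: coalgebra_def)
    then have "Fm X W (compose X g f) (\<alpha> x) = Fm Y W g (Fm X Y f (\<alpha> x))"
      by (intro functor_compose_apply[OF F]) (use fg in auto)
    also have "\<dots> = \<delta> (g (f x))"
      using coalgebra_hom_apply[OF f x] coalgebra_hom_apply[OF g, of "f x"] fg x by auto
    finally show ?thesis
      using x by (simp add: compose_eq)
  qed
qed

section \<open>Terminal coalgebras\<close>

lemma terminal_coalgebra_endo:
  assumes "set_functor U F Fm" "terminal_coalgebra U F Fm Z \<gamma>" "coalgebra_hom Fm Z \<gamma> Z \<gamma> h"
  shows "h = (\<lambda>z\<in>Z. z)"
  using assms coalgebra_hom_id unfolding terminal_coalgebra_def by metis

text \<open>The composite of \<open>f\<close> with the unique \<open>h\<close> is an endomorphism of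
  the terminal coalgebra, hence the identity. One \<open>h\<close> serves every \<open>f\<close>, so
  two different morphisms into \<open>W\<close> can be compared through it.\<close>

lemma terminal_coalgebra_hom_inj:
  assumes F: "set_functor U F Fm" and Z: "terminal_coalgebra U F Fm Z \<gamma>"
    and W: "coalgebra U F W \<delta>"
  obtains h where "coalgebra_hom Fm W \<delta> Z \<gamma> h"
    "\<And>f z. coalgebra_hom Fm Z \<gamma> W \<delta> f \<Longrightarrow> z \<in> Z \<Longrightarrow> h (f z) = z"
proof -
  have co: "coalgebra U F Z \<gamma>"
    using Z by (simp add: terminal_coalgebra_def)
  obtain h where h: "coalgebra_hom Fm W \<delta> Z \<gamma> h"
    using Z W unfolding terminal_coalgebra_def by blast
  have "h (f z) = z" if f: "coalgebra_hom Fm Z \<gamma> W \<delta> f" and z: "z \<in> Z" for f z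
  proof -
    have "compose Z h f = (\<lambda>z\<in>Z. z)"
      by (rule terminal_coalgebra_endo[OF F Z coalgebra_hom_compose[OF F co W co f h]])
    then show ?thesis
      using z by (metis compose_eq restrict_apply')
  qed
  with h show thesis
    by (rule that)
qed

text \<open>The half of Lambek's lemma used for soundness: \<gamma> is a morphism into its own image
  under the functor, so it has a left inverse \<open>h\<close> that is a morphism back. That
  equation for \<open>h\<close> and functoriality give \<gamma> h = F h F \<gamma> = F (h \<gamma>)
  = 1.\<close>

lemma terminal_coalgebra_surj:
  assumes F: "set_functor U F Fm" and Z: "terminal_coalgebra U F Fm Z \<gamma>" and a: "a \<in> F Z"
  obtains z where "z \<in> Z" "\<gamma> z = a"
proof -
  have U: "Z \<in> U" "F Z \<in> U" and \<gamma>: "\<gamma> \<in> Z \<rightarrow>\<^sub>E F Z"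
    using Z F by (auto simp: terminal_coalgebra_def coalgebra_def set_functor_def)
  let ?\<delta> = "Fm Z (F Z) \<gamma>"
  have "coalgebra U F (F Z) ?\<delta>"
    using functor_map[OF F U \<gamma>] U by (simp add: coalgebra_def)
  then obtain h where h: "coalgebra_hom Fm (F Z) ?\<delta> Z \<gamma> h"
    and left_inv: "\<And>f z. coalgebra_hom Fm Z \<gamma> (F Z) ?\<delta> f \<Longrightarrow> z \<in> Z \<Longrightarrow> h (f z) = z"
    by (rule terminal_coalgebra_hom_inj[OF F Z]) blast
  have hm: "h \<in> F Z \<rightarrow>\<^sub>E Z"
    using h by (simp add: coalgebra_hom_def)
  have "coalgebra_hom Fm Z \<gamma> (F Z) ?\<delta> \<gamma>"
    by (rule coalgebra_homI) (use \<gamma> in auto)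
  then have "compose Z h \<gamma> = (\<lambda>z\<in>Z. z)"
    using left_inv by (auto simp: compose_def)
  then have "Fm (F Z) Z h (?\<delta> a) = a"
    using functor_compose_apply[OF F U(1,2,1) \<gamma> hm a] functor_id[OF F U(1)] a by simp
  then have "\<gamma> (h a) = a"
    using coalgebra_hom_apply[OF h a] by simp
  with hm a show thesis
    by (intro that[of "h a"]) auto
qed

section \<open>Relational connectors and simulations, pointwise\<close>

lemma connector_iff:
  assumes "set_functor U F Fm" "relational_connector U F Fm R"
    and "X \<in> U" "Y \<in> U" "A \<in> U" "B \<in> U" "f \<in> A \<rightarrow>\<^sub>E X" "g \<in> B \<rightarrow>\<^sub>E Y" "r \<subseteq> X \<times> Y"
  shows "(a, b) \<in> R A B {(x, y). x \<in> A \<and> y \<in> B \<and> (f x, g y) \<in> r} \<longleftrightarrow>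
    a \<in> F A \<and> b \<in> F B \<and> (Fm A X f a, Fm B Y g b) \<in> R X Y r"
proof -
  have "graph_of A f O r O (graph_of B g)\<inverse> = {(x, y). x \<in> A \<and> y \<in> B \<and> (f x, g y) \<in> r}"
    unfolding graph_of_def by auto
  moreover have "R A B (graph_of A f O r O (graph_of B g)\<inverse>) =
      graph_of (F A) (Fm A X f) O R X Y r O (graph_of (F B) (Fm B Y g))\<inverse>"
    using assms unfolding relational_connector_def by blast
  ultimately show ?thesis
    unfolding graph_of_def by auto
qed

lemma connector_mono:
  assumes "relational_connector U F Fm R" "X \<in> U" "Y \<in> U" "r \<subseteq> s" "s \<subseteq> X \<times> Y"
  shows "R X Y r \<subseteq> R X Y s"
proof -
  have "\<forall>X\<in>U. \<forall>Y\<in>U. \<forall>r s. r \<subseteq> s \<longrightarrow> s \<subseteq> X \<times> Y \<longrightarrow> R X Y r \<subseteq> R X Y s"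
    using assms(1) by (simp add: relational_connector_def relator_def)
  with assms(2-5) show ?thesis
    by simp
qed

lemma connector_carrier:
  assumes "relational_connector U F Fm R" "X \<in> U" "Y \<in> U" "r \<subseteq> X \<times> Y"
  shows "R X Y r \<subseteq> F X \<times> F Y"
proof -
  have "\<forall>X\<in>U. \<forall>Y\<in>U. \<forall>r. r \<subseteq> X \<times> Y \<longrightarrow> R X Y r \<subseteq> F X \<times> F Y"
    using assms(1) by (simp add: relational_connector_def relator_def)
  with assms(2-4) show ?thesis
    by simp
qed

lemma connector_refl:
  assumes "relational_connector U F Fm R" "X \<in> U"
  shows "Id_on (F X) \<subseteq> R X X (Id_on X)"
  using assms by (simp add: relational_connector_def)

lemma simulation_iff:
  "simulation R X \<alpha> Y \<beta> r \<longleftrightarrow> r \<subseteq> X \<times> Y \<and> (\<forall>(x, y)\<in>r. (\<alpha> x, \<beta> y) \<in> R X Y r)"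
proof -
  have "graph_of X \<alpha> O R X Y r O (graph_of Y \<beta>)\<inverse> =
      {(x, y). x \<in> X \<and> y \<in> Y \<and> (\<alpha> x, \<beta> y) \<in> R X Y r}"
    unfolding graph_of_def by auto
  then show ?thesis
    unfolding simulation_def by auto
qed

text \<open>This moves any simulation to the terminal coalgebra, where soundness becomes a statement
  about a single structure.\<close>

lemma simulation_image:
  assumes F: "set_functor U F Fm" and R: "relational_connector U F Fm R"
    and co: "coalgebra U F X \<alpha>" "coalgebra U F Y \<beta>" "Z \<in> U"
    and f: "coalgebra_hom Fm X \<alpha> Z \<gamma> f" and g: "coalgebra_hom Fm Y \<beta> Z \<gamma> g"
    and r: "simulation R X \<alpha> Y \<beta> r"
  shows "simulation R Z \<gamma> Z \<gamma> ((\<lambda>(x, y). (f x, g y)) ` r)" (is "simulation _ _ _ _ _ ?s")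
  unfolding simulation_iff
proof (intro conjI ballI)
  have fg: "f \<in> X \<rightarrow>\<^sub>E Z" "g \<in> Y \<rightarrow>\<^sub>E Z"
    using f g by (auto simp: coalgebra_hom_def)
  have U: "X \<in> U" "Y \<in> U"
    using co by (auto simp: coalgebra_def)
  have rXY: "r \<subseteq> X \<times> Y"
    using r by (simp add: simulation_iff)
  then show s: "?s \<subseteq> Z \<times> Z"
    using fg by auto
  fix p assume "p \<in> ?s"
  then obtain x y where p: "p = (f x, g y)" and xy: "(x, y) \<in> r"
    by auto
  have "(\<alpha> x, \<beta> y) \<in> R X Y r"
    using r xy by (auto simp: simulation_iff)
  \<comment> \<open>A relation lies in the inverse image of its direct image;
    \<open>connector_iff\<close> then evaluates \<open>R\<close> on that inverse image.\<close>
  moreover have "R X Y r \<subseteq> R X Y {(x, y). x \<in> X \<and> y \<in> Y \<and> (f x, g y) \<in> ?s}"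
    by (rule connector_mono[OF R U]) (use rXY in force)+
  ultimately have "(\<alpha> x, \<beta> y) \<in> R X Y {(x, y). x \<in> X \<and> y \<in> Y \<and> (f x, g y) \<in> ?s}"
    by blast
  then have "(Fm X Z f (\<alpha> x), Fm Y Z g (\<beta> y)) \<in> R Z Z ?s"
    using connector_iff[OF F R co(3) co(3) U fg s] by blast
  then show "case p of (z, w) \<Rightarrow> (\<gamma> z, \<gamma> w) \<in> R Z Z ?s"
    using p rXY xy coalgebra_hom_apply[OF f] coalgebra_hom_apply[OF g] by auto
qed

text \<open>The inverse image of the diagonal along an injection is the diagonal. Injectivity of
  \<open>Fm A Z m\<close> is a separate assumption because a functor may fail to preserve injections
  out of the empty set.\<close>

lemma connector_injective_Id_on:
  assumes F: "set_functor U F Fm" and R: "relational_connector U F Fm R"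
    and U: "A \<in> U" "Z \<in> U" and m: "m \<in> A \<rightarrow>\<^sub>E Z" "inj_on m A" "inj_on (Fm A Z m) (F A)"
    and Z: "R Z Z (Id_on Z) \<subseteq> Id_on (F Z)"
  shows "R A A (Id_on A) = Id_on (F A)"
proof
  show "Id_on (F A) \<subseteq> R A A (Id_on A)"
    by (rule connector_refl[OF R U(1)])
  have Id: "{(x, y). x \<in> A \<and> y \<in> A \<and> (m x, m y) \<in> Id_on Z} = Id_on A"
    using m(1,2) by (auto simp: Id_on_iff dest: inj_onD)
  show "R A A (Id_on A) \<subseteq> Id_on (F A)"
  proof clarify
    fix a b assume "(a, b) \<in> R A A (Id_on A)"
    then have "a \<in> F A \<and> b \<in> F A \<and> (Fm A Z m a, Fm A Z m b) \<in> R Z Z (Id_on Z)"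
      using connector_iff[OF F R U(2,2,1,1) m(1,1), of "Id_on Z"] Id by auto
    then show "(a, b) \<in> Id_on (F A)"
      using Z m(3) by (auto dest: inj_onD)
  qed
qed

section \<open>Soundness and the diagonal of the terminal coalgebra\<close>

lemma simulation_terminal_coalgebra:
  assumes F: "set_functor U F Fm" and Z: "terminal_coalgebra U F Fm Z \<gamma>"
    and R: "relational_connector U F Fm R" and Id: "R Z Z (Id_on Z) \<subseteq> Id_on (F Z)"
    and s: "simulation R Z \<gamma> Z \<gamma> s"
  shows "s \<subseteq> Id"
proof -
  have U: "Z \<in> U" and \<gamma>: "\<gamma> \<in> Z \<rightarrow>\<^sub>E F Z"
    using Z by (auto simp: terminal_coalgebra_def coalgebra_def)
  have sZ: "s \<subseteq> Z \<times> Z"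
    using s by (simp add: simulation_iff)
  \<comment> \<open>\<open>E\<close> is reflexive on the whole type, but it relates points of
    \<open>Z\<close> only to points of \<open>Z\<close>, since \<open>s\<close> does not leave
    \<open>Z\<close>.\<close>
  define E where "E = (s \<union> s\<inverse>)\<^sup>*"
  have symE: "(y, x) \<in> E" if "(x, y) \<in> E" for x y
    using that unfolding E_def
    by (metis converse_Un converse_converse rtrancl_converseI sup_commute)
  have transE: "(x, z) \<in> E" if "(x, y) \<in> E" "(y, z) \<in> E" for x y z
    using that unfolding E_def by (rule rtrancl_trans)
  have EZ: "y \<in> Z" if "(x, y) \<in> E" "x \<in> Z" for x y
    using that unfolding E_def by (induction) (use sZ in auto)
  \<comment> \<open>Representatives replace the quotient set, so that \<open>q\<close> is an endomap
    of \<open>Z\<close> and the assumption on \<open>R Z Z (Id_on Z)\<close> applies to it.\<close>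
  define q where "q = (\<lambda>x\<in>Z. SOME y. (x, y) \<in> E)"
  have qE: "(x, q x) \<in> E" if "x \<in> Z" for x
  proof -
    have "(x, x) \<in> E"
      by (simp add: E_def)
    then have "(x, SOME y. (x, y) \<in> E) \<in> E"
      by (rule someI)
    with that show ?thesis
      by (simp add: q_def)
  qed
  have qm: "q \<in> Z \<rightarrow>\<^sub>E Z"
    using qE EZ unfolding q_def by (intro restrict_PiE_iff[THEN iffD2]) fastforce
  \<comment> \<open>Related points have the same class, so \<open>SOME\<close> is applied to equal
    predicates.\<close>
  have q_eq: "q x = q y" if "(x, y) \<in> E" "x \<in> Z" for x y
  proof -
    have "(x, z) \<in> E \<longleftrightarrow> (y, z) \<in> E" for z
      using that symE transE by blast
    moreover have "y \<in> Z"
      by (rule EZ[OF that])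
    ultimately show ?thesis
      using that(2) by (simp add: q_def)
  qed
  define \<delta> where "\<delta> = compose Z (Fm Z Z q) \<gamma>"
  have \<delta>: "coalgebra U F Z \<delta>"
    using compose_PiE[OF \<gamma> functor_map[OF F U U qm]] U by (simp add: coalgebra_def \<delta>_def)
  have step: "Fm Z Z q (\<gamma> x) = Fm Z Z q (\<gamma> y)" if xy: "(x, y) \<in> s" for x y
  proof -
    have "(\<gamma> x, \<gamma> y) \<in> R Z Z s"
      using s xy by (auto simp: simulation_iff)
    \<comment> \<open>The right-hand relation is the kernel of \<open>q\<close>, the inverse image
      of the diagonal along \<open>q\<close>.\<close>
    moreover have "R Z Z s \<subseteq> R Z Z {(x, y). x \<in> Z \<and> y \<in> Z \<and> (q x, q y) \<in> Id_on Z}"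
    proof (rule connector_mono[OF R U U])
      have "q x = q y" if "(x, y) \<in> s" for x y
        using that sZ by (intro q_eq) (auto simp: E_def)
      then show "s \<subseteq> {(x, y). x \<in> Z \<and> y \<in> Z \<and> (q x, q y) \<in> Id_on Z}"
        using sZ qm by (auto simp: Id_on_iff)
    qed auto
    ultimately have "(Fm Z Z q (\<gamma> x), Fm Z Z q (\<gamma> y)) \<in> R Z Z (Id_on Z)"
      using connector_iff[OF F R U U U U qm qm, of "Id_on Z"] by auto
    with Id show ?thesis
      by auto
  qed
  \<comment> \<open>Steps along the converse of \<open>s\<close> are covered by symmetry of
    equality.\<close>
  have invariant: "Fm Z Z q (\<gamma> x) = Fm Z Z q (\<gamma> y)" if "(x, y) \<in> E" for x y
    using that unfolding E_def by induction (auto simp: step)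
  have "coalgebra_hom Fm Z \<gamma> Z \<delta> q"
  proof (rule coalgebra_homI[OF qm])
    fix z assume z: "z \<in> Z"
    then have "q z \<in> Z"
      using qm by auto
    then show "Fm Z Z q (\<gamma> z) = \<delta> (q z)"
      using invariant[OF qE[OF z]] by (simp add: \<delta>_def compose_eq)
  qed
  moreover obtain h where "coalgebra_hom Fm Z \<delta> Z \<gamma> h"
    and "\<And>f z. coalgebra_hom Fm Z \<gamma> Z \<delta> f \<Longrightarrow> z \<in> Z \<Longrightarrow> h (f z) = z"
    by (rule terminal_coalgebra_hom_inj[OF F Z \<delta>]) blast
  ultimately have hq: "h (q z) = z" if "z \<in> Z" for z
    using that by blast
  show ?thesis
  proof (rule subrelI)
    fix x y assume xy: "(x, y) \<in> s"
    then have "q x = q y"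
      using sZ by (intro q_eq) (auto simp: E_def)
    moreover have "x \<in> Z" "y \<in> Z"
      using sZ xy by auto
    ultimately have "x = y"
      using hq by metis
    then show "(x, y) \<in> Id"
      by simp
  qed
qed

text \<open>The two morphisms into the terminal coalgebra serve as the witnesses of behavioural
  equivalence.\<close>

lemma similarity_soundI:
  assumes F: "set_functor U F Fm" and Z: "terminal_coalgebra U F Fm Z \<gamma>"
    and R: "relational_connector U F Fm R" and Id: "R Z Z (Id_on Z) \<subseteq> Id_on (F Z)"
  shows "similarity_sound U F Fm R"
  unfolding similarity_sound_def
proof (intro allI impI subrelI)
  fix X \<alpha> Y \<beta> x y
  assume co: "coalgebra U F X \<alpha>" "coalgebra U F Y \<beta>" and "(x, y) \<in> similarity R X \<alpha> Y \<beta>"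
  then obtain r where r: "simulation R X \<alpha> Y \<beta> r" and xy: "(x, y) \<in> r"
    unfolding similarity_def by blast
  have Zco: "coalgebra U F Z \<gamma>" and U: "Z \<in> U"
    using Z by (auto simp: terminal_coalgebra_def coalgebra_def)
  obtain f g where f: "coalgebra_hom Fm X \<alpha> Z \<gamma> f" and g: "coalgebra_hom Fm Y \<beta> Z \<gamma> g"
    using Z co unfolding terminal_coalgebra_def by meson
  have "f x = g y"
    using simulation_terminal_coalgebra[OF F Z R Id simulation_image[OF F R co U f g r]] xy
    by auto
  moreover have "x \<in> X" "y \<in> Y"
    using r xy by (auto simp: simulation_iff)
  ultimately show "(x, y) \<in> behavioural_equivalence U F Fm X \<alpha> Y \<beta>"
    unfolding behavioural_equivalence_def using Zco f g by blast
qed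

lemma similarity_soundD:
  assumes F: "set_functor U F Fm" and Z: "terminal_coalgebra U F Fm Z \<gamma>"
    and R: "relational_connector U F Fm R" and sound: "similarity_sound U F Fm R"
  shows "R Z Z (Id_on Z) \<subseteq> Id_on (F Z)"
proof (rule subrelI)
  fix a b assume ab: "(a, b) \<in> R Z Z (Id_on Z)"
  have Zco: "coalgebra U F Z \<gamma>" and U: "Z \<in> U" and \<gamma>: "\<gamma> \<in> Z \<rightarrow>\<^sub>E F Z"
    using Z by (auto simp: terminal_coalgebra_def coalgebra_def)
  have F_ab: "a \<in> F Z" "b \<in> F Z"
    using connector_carrier[OF R U U, of "Id_on Z"] ab by auto
  then obtain u v where u: "u \<in> Z" "\<gamma> u = a" and v: "v \<in> Z" "\<gamma> v = b"
    using terminal_coalgebra_surj[OF F Z] by metis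
  let ?r = "insert (u, v) (Id_on Z)"
  have "R Z Z (Id_on Z) \<subseteq> R Z Z ?r"
    by (rule connector_mono[OF R U U]) (use u v in auto)
  \<comment> \<open>Diagonal pairs are sent into \<open>R Z Z (Id_on Z)\<close> by reflexivity of
    the connector, and the added pair is sent to \<open>(a, b)\<close>.\<close>
  then have "simulation R Z \<gamma> Z \<gamma> ?r"
    using u v ab \<gamma> connector_refl[OF R U] by (auto simp: simulation_iff)
  then have "(u, v) \<in> behavioural_equivalence U F Fm Z \<gamma> Z \<gamma>"
    using sound Zco unfolding similarity_sound_def similarity_def by blast
  then obtain W \<delta> f g where W: "coalgebra U F W \<delta>"
    and "coalgebra_hom Fm Z \<gamma> W \<delta> f" "coalgebra_hom Fm Z \<gamma> W \<delta> g" "f u = g v"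
    unfolding behavioural_equivalence_def by blast
  moreover obtain h where "coalgebra_hom Fm W \<delta> Z \<gamma> h"
    and "\<And>f z. coalgebra_hom Fm Z \<gamma> W \<delta> f \<Longrightarrow> z \<in> Z \<Longrightarrow> h (f z) = z"
    by (rule terminal_coalgebra_hom_inj[OF F Z W]) blast
  \<comment> \<open>The same \<open>h\<close> inverts \<open>f\<close> and \<open>g\<close>: u = h
    (f u) = h (g v) = v.\<close>
  ultimately have "u = v"
    using u(1) v(1) by metis
  with u v F_ab show "(a, b) \<in> Id_on (F Z)"
    by auto
qed

section \<open>Monomorphisms as injections\<close>

lemma inj_on_imp_monomorphism:
  fixes f :: "'a \<Rightarrow> 'a"
  assumes "f \<in> X \<rightarrow>\<^sub>E Y" "inj_on f X"
  shows "monomorphism U X Y f"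
  unfolding monomorphism_def
proof (intro conjI ballI impI)
  fix W :: "'a set" and g h :: "'a \<Rightarrow> 'a"
  assume gh: "g \<in> W \<rightarrow>\<^sub>E X" "h \<in> W \<rightarrow>\<^sub>E X" and eq: "compose W f g = compose W f h"
  have "g w = h w" if "w \<in> W" for w
  proof (rule inj_onD[OF assms(2)])
    show "f (g w) = f (h w)"
      using fun_cong[OF eq, of w] that by (simp add: compose_eq)
  qed (use gh that in auto)
  with gh show "g = h"
    by (rule PiE_ext)
qed (rule assms(1))

text \<open>Elements of \<open>X\<close> correspond to morphisms from a singleton, and the universe
  contains one.\<close>

lemma monomorphism_imp_inj_on:
  assumes U: "set_universe U" and f: "monomorphism U X Y f"
  shows "inj_on f X"
proof (rule inj_onI)
  fix x y assume xy: "x \<in> X" "y \<in> X" "f x = f y"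
  obtain p where p: "{p} \<in> U"
    using U by (auto simp: set_universe_def)
  let ?c = "\<lambda>z. \<lambda>w\<in>{p}. z"
  have "?c x \<in> {p} \<rightarrow>\<^sub>E X" "?c y \<in> {p} \<rightarrow>\<^sub>E X" "compose {p} f (?c x) = compose {p} f (?c y)"
    using xy by (auto simp: compose_def)
  then have "?c x = ?c y"
    using f p unfolding monomorphism_def by blast
  then have "?c x p = ?c y p"
    by (rule fun_cong)
  then show "x = y"
    by simp
qed

theorem theorem11:
  fixes U :: "'a set set"
    and F :: "'a set \<Rightarrow> 'a set"
    and Fm :: "'a set \<Rightarrow> 'a set \<Rightarrow> ('a \<Rightarrow> 'a) \<Rightarrow> 'a \<Rightarrow> 'a"
    and R :: "'a set \<Rightarrow> 'a set \<Rightarrow> ('a \<times> 'a) set \<Rightarrow> ('a \<times> 'a) set"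
    and Z :: "'a set"
    and \<gamma> :: "'a \<Rightarrow> 'a"
  assumes "set_universe U"
    and "set_functor U F Fm"
    and "terminal_coalgebra U F Fm Z \<gamma>"
    and "relational_connector U F Fm R"
  shows "(similarity_sound U F Fm R \<longleftrightarrow> R Z Z (Id_on Z) = Id_on (F Z)) \<and>
    (preserves_monomorphisms U F Fm \<longrightarrow>
      (similarity_sound U F Fm R \<longleftrightarrow>
        (\<forall>A\<in>U. A \<lesssim> Z \<longrightarrow> R A A (Id_on A) = Id_on (F A))))"
proof (intro conjI impI)
  note F = assms(2) and Z = assms(3) and R = assms(4)
  have U: "Z \<in> U"
    using Z by (simp add: terminal_coalgebra_def coalgebra_def)
  show sound: "similarity_sound U F Fm R \<longleftrightarrow> R Z Z (Id_on Z) = Id_on (F Z)"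
    using similarity_soundI[OF F Z R] similarity_soundD[OF F Z R] connector_refl[OF R U] by auto
  assume pres: "preserves_monomorphisms U F Fm"
  have "R A A (Id_on A) = Id_on (F A)"
    if A: "A \<in> U" "A \<lesssim> Z" and Id: "R Z Z (Id_on Z) = Id_on (F Z)" for A
  proof -
    obtain m where "inj_on m A" "m ` A \<subseteq> Z"
      using A(2) by (auto simp: lepoll_def)
    \<comment> \<open>Restriction makes the injection extensional, hence a morphism.\<close>
    then have m: "restrict m A \<in> A \<rightarrow>\<^sub>E Z" "inj_on (restrict m A) A"
      by auto
    then have "monomorphism U A Z (restrict m A)"
      by (rule inj_on_imp_monomorphism)
    then have "monomorphism U (F A) (F Z) (Fm A Z (restrict m A))"
      using pres A(1) U unfolding preserves_monomorphisms_def by blast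
    then have "inj_on (Fm A Z (restrict m A)) (F A)"
      by (rule monomorphism_imp_inj_on[OF assms(1)])
    with m Id show ?thesis
      by (intro connector_injective_Id_on[OF F R A(1) U, where m = "restrict m A"]) auto
  qed
  \<comment> \<open>Conversely, the condition on all small \<open>A\<close> includes the case of
    \<open>Z\<close> itself.\<close>
  with sound U lepoll_refl[of Z] show "similarity_sound U F Fm R \<longleftrightarrow>
      (\<forall>A\<in>U. A \<lesssim> Z \<longrightarrow> R A A (Id_on A) = Id_on (F A))"
    by blast
qed

end
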